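(* Let $R$ be a ring. For an integer $n \ge 1$, let $P(n)$ denote the following property of $R$: for all $m \ge 1$ and all $A_1, \ldots, A_m \in M_n(R)$ with $A_1 + \cdots + A_m$ invertible, there exists $S \subseteq [m]$ with $|S| \le n$ such that $\sum_{i \in S} A_i$ is invertible. Then the following are equivalent: (i) $R$ is local, i.e. has a unique maximal ideal $\mathfrak{m}$; (ii) $P(n)$ holds for all $n \ge 1$; (ii') $P(n)$ holds for some $n \ge 1$.
   Context: All rings, except for matrix rings, are commutative with $1 \ne 0$. Local rings are not assumed Noetherian. $M_n(R)$ is the ring of $n \times n$ matrices over $R$, and invertible means invertible in $M_n(R)$. $[m] = \{1, \ldots, m\}$, and $|S|$ denotes the cardinality of $S$. *)

theory Defs
  imports "Jordan_Normal_Form.Matrix" "Jordan_Normal_Form.VS_Connect" "HOL-Algebra.Ideal"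
begin

(* The ring R is the type 'a; class_ring is the record with carrier UNIV built from its class
   operations, so that the HOL-Algebra notion of maximal ideal applies.  Class comm_ring_1
   includes 0 \<noteq> 1. *)

definition local_ring :: "'a::comm_ring_1 itself \<Rightarrow> bool" where
  "local_ring ty \<longleftrightarrow> (\<exists>!I :: 'a set. maximalideal I class_ring)"

abbreviation matrix_ring :: "'a::comm_ring_1 itself \<Rightarrow> nat \<Rightarrow> 'a mat ring" where
  "matrix_ring ty n \<equiv> ring_mat ty n ()"

(* Sums of matrices are taken in the ring of n x n matrices, since the type of matrices of
   all sizes has no zero element; the empty sum is the n x n zero matrix. *)

definition subsum_property :: "'a::comm_ring_1 itself \<Rightarrow> nat \<Rightarrow> bool" where
  "subsum_property ty n \<longleftrightarrow>
    (\<forall>m\<ge>1. \<forall>A :: nat \<Rightarrow> 'a mat.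
      (\<forall>i\<in>{1..m}. A i \<in> carrier (matrix_ring ty n)) \<longrightarrow>
      finsum (matrix_ring ty n) A {1..m} \<in> Units (matrix_ring ty n) \<longrightarrow>
      (\<exists>S\<subseteq>{1..m}. card S \<le> n \<and>
        finsum (matrix_ring ty n) A S \<in> Units (matrix_ring ty n)))"

end

theory Submission
  imports Defs "Jordan_Normal_Form.Determinant" "HOL-Algebra.Ring_Divisibility"
begin

text \<open>A ring is local iff a sum can only be a unit when one of its summands is.
  By multilinearity of the determinant, det (\<Sum>i\<in>S. A i) is the sum, over all maps g from the
  row indices to S, of the determinant of the matrix whose row i is row i of A (g i). Grouping by
  the range T of g writes it as \<Sum>T\<subseteq>S. c T, where c T = 0 as soon as card T > n. If the total
  determinant is a unit, some c T is a unit over a local ring; for a minimal such T we have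
  card T \<le> n, and the determinant of the subsum over T is c T plus non-units, hence a unit.
  Conversely, if a + b is a unit with non-units a and b, then the n - 1 diagonal matrix units
  E_ii with i \<ge> 1 together with a E_00 and b E_00 violate the property.\<close>

section \<open>Local rings\<close>

text \<open>Zorn's lemma on the ideals that contain \<open>I\<close> and omit 1: all these
  conditions pass to the union of a nonempty chain.\<close>

lemma (in ring) exists_maximalideal_superset:
  assumes I: "ideal I R" "\<one> \<notin> I"
  shows "\<exists>M. maximalideal M R \<and> I \<subseteq> M"
proof -
  let ?P = "{J. ideal J R \<and> I \<subseteq> J \<and> \<one> \<notin> J}"
  have "\<exists>M\<in>?P. \<forall>X\<in>?P. M \<subseteq> X \<longrightarrow> X = M"
  proof (rule subset_Zorn_nonempty)
    show "?P \<noteq> {}" using I by blast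
    fix C assume C: "C \<noteq> {}" "subset.chain ?P C"
    have "ideal (\<Union>C) R"
      using chain_Union_is_ideal[of C] C by (auto simp: subset_chain_def split: if_splits)
    then show "\<Union>C \<in> ?P"
      using C by (auto simp: subset_chain_def)
  qed
  then obtain M where "M \<in> ?P" and max: "\<forall>X\<in>?P. M \<subseteq> X \<longrightarrow> X = M" ..
  then have M: "ideal M R" "I \<subseteq> M" "\<one> \<notin> M"
    by simp_all
  have "maximalideal M R"
  proof (rule maximalidealI[OF M(1)])
    show "carrier R \<noteq> M" using M(3) by blast
    show "J = M \<or> J = carrier R" if "ideal J R" "M \<subseteq> J" "J \<subseteq> carrier R" for J
    proof (cases "\<one> \<in> J")
      case False
      then show ?thesis using that max M(2) by simp
    qed (use that(1) in \<open>simp add: ideal.one_imp_carrier\<close>)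
  qed
  then show ?thesis using M(2) by blast
qed

lemma ideal_class_ring_iff:
  "ideal (I :: 'a::comm_ring_1 set) class_ring \<longleftrightarrow>
    0 \<in> I \<and> (\<forall>x\<in>I. \<forall>y\<in>I. x + y \<in> I) \<and> (\<forall>x\<in>I. \<forall>r. r * x \<in> I)" (is "_ \<longleftrightarrow> ?R")
proof
  assume I: "ideal I class_ring"
  then interpret ideal I "class_ring :: 'a ring" .
  show ?R
    using a_closed I_l_closed zero_closed by auto
next
  assume R: ?R
  \<comment> \<open>Closure under negation is multiplication by -1.\<close>
  have uminus: "- x \<in> I" if "x \<in> I" for x
    using R that by (metis mult_minus1)
  show "ideal I class_ring"
  proof (rule idealI)
    show "ring (class_ring :: 'a ring)" by (rule class_ring.ring_axioms)
    show "subgroup I (add_monoid (class_ring :: 'a ring))"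
    proof (rule group.subgroupI[OF abelian_group.a_group[OF ring.is_abelian_group]])
      show "ring (class_ring :: 'a ring)" by (rule class_ring.ring_axioms)
      show "inv\<^bsub>add_monoid class_ring\<^esub> a \<in> I" if "a \<in> I" for a
        using uminus[OF that] unfolding a_inv_def[symmetric] unfolding class_ring_simps .
    qed (use R in auto)
  qed (use R in \<open>auto simp: mult.commute\<close>)
qed

lemma maximalideal_no_units:
  assumes "maximalideal (M :: 'a::comm_ring_1 set) class_ring" "x \<in> M"
  shows "\<not> x dvd 1"
proof
  interpret maximalideal M "class_ring :: 'a ring" by (rule assms(1))
  assume "x dvd 1"
  then obtain y where "1 = x * y" ..
  then have "1 \<in> M"
    using I_r_closed[OF assms(2), of y] by simp
  then show False
    using I_notcarr one_imp_carrier by simp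
qed

lemma nonunit_in_maximalideal:
  assumes "\<not> (x :: 'a::comm_ring_1) dvd 1"
  shows "\<exists>M. maximalideal M (class_ring :: 'a ring) \<and> x \<in> M"
proof -
  have "ideal (range (\<lambda>r. r * x)) (class_ring :: 'a ring)"
    unfolding ideal_class_ring_iff
    by (auto simp: image_iff distrib_right[symmetric] mult.assoc[symmetric] intro: exI[of _ 0])
  moreover have "1 \<notin> range (\<lambda>r. r * x)"
    using assms by (metis dvd_triv_right rangeE)
  moreover have "x \<in> range (\<lambda>r. r * x)"
    by (rule range_eqI[of _ _ 1]) simp
  ultimately show ?thesis
    using class_ring.exists_maximalideal_superset by blast
qed

text \<open>Every nonunit lies in some maximal ideal, so if there is only one, it contains all
  nonunits and hence their sums, which are therefore nonunits. Conversely, the condition makes the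
  nonunits an ideal; it is maximal, and it contains every maximal ideal, so it is the only
  one.\<close>

lemma local_ring_iff:
  "local_ring TYPE('a::comm_ring_1) \<longleftrightarrow>
    (\<forall>x y :: 'a. x + y dvd 1 \<longrightarrow> x dvd 1 \<or> y dvd 1)" (is "_ \<longleftrightarrow> ?R")
proof
  assume "local_ring TYPE('a)"
  then obtain M :: "'a set" where M: "maximalideal M class_ring"
    and unique: "\<And>I :: 'a set. maximalideal I class_ring \<Longrightarrow> I = M"
    unfolding local_ring_def by blast
  have "x \<in> M" if "\<not> x dvd 1" for x
    using nonunit_in_maximalideal[OF that] unique by blast
  moreover have "x + y \<in> M" if "x \<in> M" "y \<in> M" for x y
    using that maximalideal.axioms(1)[OF M] unfolding ideal_class_ring_iff by blast
  ultimately show ?R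
    using maximalideal_no_units[OF M] by blast
next
  assume R: ?R
  let ?N = "{x :: 'a. \<not> x dvd 1}"
  have N: "ideal ?N class_ring"
    unfolding ideal_class_ring_iff using R by (auto dest: dvd_mult_right)
  have max: "maximalideal ?N class_ring"
  proof (rule maximalidealI[OF N])
    have "1 \<notin> ?N" by simp
    then show "carrier class_ring \<noteq> ?N" by (metis UNIV_I class_ring_simps(1))
    show "J = ?N \<or> J = carrier class_ring" if "ideal J class_ring" "?N \<subseteq> J" for J :: "'a set"
    proof (cases "J = ?N")
      case False
      then have "\<not> J \<subseteq> ?N" using that(2) by (simp only: subset_antisym)
      then obtain x where "x \<in> J" "x dvd 1" by blast
      then obtain y where "y * x = 1" by (metis dvdE mult.commute)
      then have "1 \<in> J"
        using that(1) \<open>x \<in> J\<close> unfolding ideal_class_ring_iff by metis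
      then show ?thesis
        using ideal.one_imp_carrier[OF that(1)] by simp
    qed simp
  qed
  moreover have "I = ?N" if I: "maximalideal I class_ring" for I :: "'a set"
  proof -
    have "?N = I \<or> ?N = carrier class_ring"
      by (rule maximalideal.I_maximal[OF I N]) (use maximalideal_no_units[OF I] in auto)
    then show ?thesis
      using maximalideal.I_notcarr[OF max] by metis
  qed
  ultimately show "local_ring TYPE('a)"
    unfolding local_ring_def by blast
qed

lemma local_ring_sum_unit:
  assumes "local_ring TYPE('a::comm_ring_1)" "finite A" "sum (f :: _ \<Rightarrow> 'a) A dvd 1"
  shows "\<exists>x\<in>A. f x dvd 1"
  using assms(2,3)
proof (induction A)
  case (insert x A)
  then have "f x dvd 1 \<or> sum f A dvd 1"
    using assms(1) unfolding local_ring_iff by simp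
  then show ?case
    using insert.IH by blast
qed simp

section \<open>Matrices\<close>

lemma mat_Units_iff_det:
  "A \<in> Units (matrix_ring TYPE('a::comm_ring_1) n) \<longleftrightarrow> A \<in> carrier_mat n n \<and> det A dvd 1"
proof
  assume "A \<in> Units (matrix_ring TYPE('a) n)"
  then obtain B where A: "A \<in> carrier_mat n n" and "B \<in> carrier_mat n n" "A * B = 1\<^sub>m n"
    unfolding Units_def ring_mat_simps by blast
  then have "det A * det B = 1" by (metis det_mult det_one)
  then show "A \<in> carrier_mat n n \<and> det A dvd 1" using A by (metis dvdI)
next
  assume A: "A \<in> carrier_mat n n \<and> det A dvd 1"
  then obtain c where c: "det A * c = 1" by (metis dvdE)
  \<comment> \<open>The inverse is the adjugate scaled by the inverse \<open>c\<close> of the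
    determinant.\<close>
  define B where "B = c \<cdot>\<^sub>m adj_mat A"
  have "B \<in> carrier_mat n n" "A * B = 1\<^sub>m n" "B * A = 1\<^sub>m n"
    using adj_mat[of A n] A c
    by (auto simp: B_def mult_smult_distrib[of A n n _ n] mult_smult_assoc_mat[of _ n n A n]
        mult.commute intro!: eq_matI)
  then show "A \<in> Units (matrix_ring TYPE('a) n)"
    using A unfolding Units_def ring_mat_simps by blast
qed

lemma finsum_mat_carrier:
  assumes "\<And>k. k \<in> S \<Longrightarrow> A k \<in> carrier_mat n n"
  shows "finsum (matrix_ring TYPE('a::comm_ring_1) n) A S \<in> carrier_mat n n"
proof -
  interpret ring "matrix_ring TYPE('a) n" by (rule ring_mat)
  show ?thesis
    using finsum_closed[of A S] assms by (auto simp: ring_mat_simps)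
qed

lemma finsum_mat_index:
  assumes "finite S" "\<And>k. k \<in> S \<Longrightarrow> A k \<in> carrier_mat n n" "i < n" "j < n"
  shows "finsum (matrix_ring TYPE('a::comm_ring_1) n) A S $$ (i, j) = (\<Sum>k\<in>S. A k $$ (i, j))"
  using assms(1,2)
proof (induction S)
  case empty
  interpret ring "matrix_ring TYPE('a) n" by (rule ring_mat)
  show ?case using assms(3,4) by (simp add: ring_mat_simps)
next
  case (insert k S)
  interpret ring "matrix_ring TYPE('a) n" by (rule ring_mat)
  have "finsum (matrix_ring TYPE('a) n) A (insert k S) = A k + finsum (matrix_ring TYPE('a) n) A S"
    using insert by (subst finsum_insert) (auto simp: ring_mat_simps)
  then show ?case
    using insert assms(3,4) finsum_mat_carrier[of S A n] by auto
qed

text \<open>In the Leibniz formula, each product of row sums expands into a sum over the functions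
  \<open>g\<close> that choose a summand for each row. After the two sums are swapped, the inner one
  is again a Leibniz formula.\<close>

lemma det_finsum:
  fixes A :: "'b \<Rightarrow> 'a::comm_ring_1 mat"
  assumes S: "finite S" and A: "\<And>k. k \<in> S \<Longrightarrow> A k \<in> carrier_mat n n"
  shows "det (finsum (matrix_ring TYPE('a) n) A S) =
    (\<Sum>g\<in>{0..<n} \<rightarrow>\<^sub>E S. det (mat n n (\<lambda>(i, j). A (g i) $$ (i, j))))"
proof -
  let ?P = "{p. p permutes {0..<n}}"
  have carr: "finsum (matrix_ring TYPE('a) n) A S \<in> carrier_mat n n"
    using A by (rule finsum_mat_carrier)
  have "det (finsum (matrix_ring TYPE('a) n) A S) =
      (\<Sum>p\<in>?P. signof p * (\<Prod>i=0..<n. \<Sum>k\<in>S. A k $$ (i, p i)))"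
    unfolding det_def'[OF carr]
    by (intro sum.cong prod.cong arg_cong2[where f = "(*)"] refl finsum_mat_index S A)
       (auto dest: permutes_in_image[where x = i for i])
  also have "\<dots> = (\<Sum>p\<in>?P. \<Sum>g\<in>{0..<n} \<rightarrow>\<^sub>E S. signof p * (\<Prod>i=0..<n. A (g i) $$ (i, p i)))"
    using S by (simp add: prod_sum_PiE sum_distrib_left)
  also have "\<dots> = (\<Sum>g\<in>{0..<n} \<rightarrow>\<^sub>E S. \<Sum>p\<in>?P. signof p * (\<Prod>i=0..<n. A (g i) $$ (i, p i)))"
    by (rule sum.swap)
  also have "\<dots> = (\<Sum>g\<in>{0..<n} \<rightarrow>\<^sub>E S. det (mat n n (\<lambda>(i, j). A (g i) $$ (i, j))))"
    unfolding det_def'[OF mat_carrier]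
    by (intro sum.cong prod.cong arg_cong2[where f = "(*)"] refl) (auto dest: permutes_in_image[where x = i for i])
  finally show ?thesis .
qed

section \<open>The subsum property\<close>

lemma local_ring_imp_subsum_property:
  assumes loc: "local_ring TYPE('a::comm_ring_1)"
  shows "subsum_property TYPE('a) n"
  unfolding subsum_property_def
proof (intro allI impI)
  fix m :: nat and A :: "nat \<Rightarrow> 'a mat"
  assume "\<forall>i\<in>{1..m}. A i \<in> carrier (matrix_ring TYPE('a) n)"
  then have A: "A i \<in> carrier_mat n n" if "i \<in> {1..m}" for i
    using that by (simp add: ring_mat_simps)
  assume unit: "finsum (matrix_ring TYPE('a) n) A {1..m} \<in> Units (matrix_ring TYPE('a) n)"
  \<comment> \<open>\<open>onto T\<close> consists of the row choices that use exactly the matrices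
    indexed by \<open>T\<close>. Hence \<open>c T\<close> does not depend on the ambient index set
    \<open>S\<close>, and one function \<open>c\<close> describes the determinants of all
    subsums.\<close>
  define onto where "onto T = {g \<in> {0..<n} \<rightarrow>\<^sub>E T. g ` {0..<n} = T}" for T :: "nat set"
  define c where "c T = (\<Sum>g\<in>onto T. det (mat n n (\<lambda>(i, j). A (g i) $$ (i, j))))" for T
  have det: "det (finsum (matrix_ring TYPE('a) n) A S) = sum c (Pow S)" if S: "S \<subseteq> {1..m}" for S
  proof -
    have fin: "finite S" using S finite_subset by blast
    have onto: "onto T = {g \<in> {0..<n} \<rightarrow>\<^sub>E S. g ` {0..<n} = T}" if "T \<in> Pow S" for T
      using that unfolding onto_def by (auto simp: PiE_iff)
    have "sum c (Pow S) = (\<Sum>g\<in>{0..<n} \<rightarrow>\<^sub>E S. det (mat n n (\<lambda>(i, j). A (g i) $$ (i, j))))"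
      unfolding c_def using fin
      by (subst sum.group[symmetric, where T = "Pow S" and g = "\<lambda>g. g ` {0..<n}"])
         (auto simp: onto finite_PiE intro!: sum.cong)
    moreover have "det (finsum (matrix_ring TYPE('a) n) A S) =
        (\<Sum>g\<in>{0..<n} \<rightarrow>\<^sub>E S. det (mat n n (\<lambda>(i, j). A (g i) $$ (i, j))))"
      using fin A S by (intro det_finsum) auto
    ultimately show ?thesis by simp
  qed
  have card: "card T \<le> n" if T: "c T dvd 1" for T
  proof -
    \<comment> \<open>An empty sum would make \<open>c T\<close> zero, which is not a unit; so n
      rows suffice to hit all of \<open>T\<close>.\<close>
    have "onto T \<noteq> {}" using T unfolding c_def by (intro notI) simp
    then obtain g :: "nat \<Rightarrow> nat" where "T = g ` {0..<n}" unfolding onto_def by blast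
    then show ?thesis using card_image_le[of "{0..<n}" g] by simp
  qed
  have "\<exists>T\<in>Pow {1..m}. c T dvd 1"
    using unit det[of "{1..m}"] by (intro local_ring_sum_unit[OF loc]) (auto simp: mat_Units_iff_det)
  \<comment> \<open>\<open>T\<close> is chosen of least cardinality among the index sets with
    \<open>c T\<close> a unit.\<close>
  then obtain T where T: "T \<subseteq> {1..m}" "c T dvd 1"
    and min: "\<And>T'. T' \<subseteq> {1..m} \<Longrightarrow> c T' dvd 1 \<Longrightarrow> card T \<le> card T'"
    using ex_has_least_nat[of "\<lambda>T. T \<subseteq> {1..m} \<and> c T dvd 1" _ card] by (metis Pow_iff)
  have fin: "finite T" using T(1) finite_subset by blast
  let ?r = "sum c (Pow T - {T})"
  \<comment> \<open>If \<open>?r\<close> were a unit, some proper subset of \<open>T\<close> would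
    carry a unit term, against minimality.\<close>
  have "\<not> ?r dvd 1"
  proof
    assume "?r dvd 1"
    then obtain T' where "T' \<in> Pow T - {T}" "c T' dvd 1"
      using local_ring_sum_unit[OF loc, of "Pow T - {T}" c] fin by auto
    then show False
      using min[of T'] T(1) psubset_card_mono[OF fin, of T'] by fastforce
  qed
  \<comment> \<open>The unit \<open>c T\<close> is split into two summands, of which
    \<open>- ?r\<close> is a nonunit; by locality the other one, the determinant of the subsum over
    \<open>T\<close>, is a unit.\<close>
  moreover have "c T = sum c (Pow T) + (- ?r)"
    using fin by (subst sum.remove[of "Pow T" T]) auto
  ultimately have "sum c (Pow T) dvd 1"
    using loc T(2) unfolding local_ring_iff by (metis minus_dvd_iff)
  then have "finsum (matrix_ring TYPE('a) n) A T \<in> Units (matrix_ring TYPE('a) n)"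
    unfolding mat_Units_iff_det det[OF T(1), symmetric]
    using finsum_mat_carrier[of T A n] A T(1) by (metis subsetD)
  then show "\<exists>S\<subseteq>{1..m}. card S \<le> n \<and>
      finsum (matrix_ring TYPE('a) n) A S \<in> Units (matrix_ring TYPE('a) n)"
    using T card by blast
qed

text \<open>The determinant is the product of the diagonal entries, and a product is a unit exactly
  when all factors are. This lets the converse direction be checked one diagonal entry at a
  time.\<close>

lemma diag_mat_Units_iff:
  "mat n n (\<lambda>(i, j). if i = j then d i else 0) \<in> Units (matrix_ring TYPE('a::comm_ring_1) n) \<longleftrightarrow>
    (\<forall>i<n. d i dvd 1)"
proof -
  let ?D = "mat n n (\<lambda>(i, j). if i = j then d i else 0)"
  have "det ?D = (\<Prod>i=0..<n. d i)"
    by (subst det_upper_triangular[of _ n]) (auto simp: prod_list_diag_prod)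
  moreover have "(\<Prod>i\<in>I. d i) dvd 1 \<longleftrightarrow> (\<forall>i\<in>I. d i dvd 1)" if "finite I" for I
    using that by (induction I) auto
  ultimately have "det ?D dvd 1 \<longleftrightarrow> (\<forall>i<n. d i dvd 1)"
    by (simp add: Ball_def)
  then show ?thesis
    unfolding mat_Units_iff_det by simp
qed

lemma subsum_property_imp_local_ring:
  assumes P: "subsum_property TYPE('a::comm_ring_1) n" and n: "n \<ge> 1"
  shows "local_ring TYPE('a)"
  unfolding local_ring_iff
proof (intro allI impI)
  fix a b :: 'a
  assume ab: "a + b dvd 1"
  \<comment> \<open>\<open>d k i\<close> is entry i of the diagonal of matrix k. Matrices are
    numbered from 1 to n + 1 but rows from 0 to n - 1, so the matrices k < n serve rows 1 to n - 1,
    and row 0 is left to the matrices n and n + 1.\<close>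
  define d :: "nat \<Rightarrow> nat \<Rightarrow> 'a" where
    "d k i = (if k = n then if i = 0 then a else 0
      else if k = n + 1 then if i = 0 then b else 0 else if i = k then 1 else 0)" for k i
  define A where "A k = mat n n (\<lambda>(i, j). if i = j then d k i else 0)" for k
  have sum: "finsum (matrix_ring TYPE('a) n) A S =
      mat n n (\<lambda>(i, j). if i = j then \<Sum>k\<in>S. d k i else 0)" if "finite S" for S
    using that finsum_mat_carrier[of S A n]
    by (intro eq_matI) (auto simp: finsum_mat_index A_def)
  have total: "(\<Sum>k\<in>{1..n+1}. d k i) dvd 1" if i: "i < n" for i
  proof (cases "i = 0")
    case True
    have "(\<Sum>k\<in>{1..n+1}. d k i) = (\<Sum>k\<in>{n, n+1}. d k i)"
      using n True by (intro sum.mono_neutral_right) (auto simp: d_def)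
    then show ?thesis using True ab by (simp add: d_def)
  next
    case False
    have "(\<Sum>k\<in>{1..n+1}. d k i) = (\<Sum>k\<in>{i}. d k i)"
      using i False by (intro sum.mono_neutral_right) (auto simp: d_def)
    then show ?thesis using i by (simp add: d_def)
  qed
  have "finsum (matrix_ring TYPE('a) n) A {1..n+1} \<in> Units (matrix_ring TYPE('a) n)"
    unfolding sum[OF finite_atLeastAtMost] diag_mat_Units_iff using total by blast
  moreover have "\<forall>k\<in>{1..n+1}. A k \<in> carrier (matrix_ring TYPE('a) n)"
    by (simp add: A_def ring_mat_simps)
  ultimately obtain S where S: "S \<subseteq> {1..n+1}" "card S \<le> n"
    and unit_S: "finsum (matrix_ring TYPE('a) n) A S \<in> Units (matrix_ring TYPE('a) n)"
    using P unfolding subsum_property_def by (meson le_add2)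
  have fin: "finite S" using S(1) finite_subset by blast
  have unit: "(\<Sum>k\<in>S. d k i) dvd 1" if "i < n" for i
    using unit_S that unfolding sum[OF fin] diag_mat_Units_iff by blast
  \<comment> \<open>Among the matrices 1 to n + 1, only matrix i has a nonzero entry in row i \<ge>
    1, so \<open>S\<close> cannot omit it.\<close>
  have "i \<in> S" if i: "1 \<le> i" "i < n" for i
  proof (rule ccontr)
    assume "i \<notin> S"
    then have "(\<Sum>k\<in>S. d k i) = 0" using i by (intro sum.neutral) (auto simp: d_def)
    then show False using unit[OF i(2)] by simp
  qed
  \<comment> \<open>The size bound forces \<open>S\<close> to omit one of the n + 1 indices, and
    only n and n + 1 remain as candidates.\<close>
  moreover have "S \<noteq> {1..n+1}" using S(2) by auto
  ultimately have "n \<notin> S \<or> n + 1 \<notin> S"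
    using S(1) by (force simp: le_Suc_eq)
  moreover have "(\<Sum>k\<in>S. d k 0) = (\<Sum>k\<in>S \<inter> {n, n+1}. d k 0)"
    using fin S(1) by (intro sum.mono_neutral_right) (auto simp: d_def)
  moreover have "(\<Sum>k\<in>S. d k 0) dvd 1"
    using unit[of 0] n by simp
  ultimately have "(\<Sum>k\<in>S \<inter> {n, n+1}. d k 0) dvd 1" "n \<notin> S \<or> n + 1 \<notin> S"
    by simp_all
  \<comment> \<open>Entry 0 of the subsum is now a, b or 0, and 0 is not a unit.\<close>
  then show "a dvd 1 \<or> b dvd 1"
    by (cases "n \<in> S"; cases "n + 1 \<in> S") (simp_all add: d_def Int_insert_right)
qed

theorem theorem5:
  shows "(local_ring TYPE('a::comm_ring_1) \<longleftrightarrow> (\<forall>n\<ge>1. subsum_property TYPE('a) n)) \<and>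
    (local_ring TYPE('a) \<longleftrightarrow> (\<exists>n\<ge>1. subsum_property TYPE('a) n))"
  using local_ring_imp_subsum_property[where 'a = 'a] subsum_property_imp_local_ring[where 'a = 'a]
  by blast

end
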